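(* Let $A:\mathbb{Z}^{+}\to M_d(\mathbb{R})$ and $f:\mathbb{Z}^{+}\times\mathbb{R}^d\to\mathbb{R}^d$ (with each $f(k,\cdot)$ continuous), and consider the systems $$(L)\quad x_{k+1}=A(k)x_k,\qquad (N)\quad y_{k+1}=A(k)y_k+f(k,y_k),\qquad k\in\mathbb{Z}^{+}.$$ Assume that: (P1) every $A(k)$ is invertible and there exists $M\ge 1$ with $\max\{\sup_{k\in\mathbb{Z}^{+}}\|A(k)\|,\ \sup_{k\in\mathbb{Z}^{+}}\|A^{-1}(k)\|\}=M$. (P3) There are sequences $\gamma,\mu$ of nonnegative reals such that for all $k\in\mathbb{Z}^{+}$ and $y,\tilde y\in\mathbb{R}^d$: $|f(k,y)-f(k,\tilde y)|\le\gamma(k)|y-\tilde y|$ and $|f(k,y)|\le\mu(k)$. (P6) $\|A^{-1}(\ell)\|\,\gamma(\ell)<1$ for all $\ell\in\mathbb{Z}^{+}$. (S1) There exist a bounded sequence $\rho$ of nonnegative reals and a decreasing sequence $h$ of positive reals converging to zero with $h(0)=1$ such that $\|\Phi(k,n)\|\le\rho(n)\frac{h(k)}{h(n)}$ for all $k\ge n\ge 0$. (S2) There is $p<\infty$ with $\sum_{j=0}^{k-1}\mu(j)\rho(j+1)\frac{h(k)}{h(j+1)}\le p$ for all $k\in\mathbb{Z}^{+}$. (S3) There is $q<1$ with $\sum_{j=0}^{k-1}\gamma(j)\rho(j+1)\frac{h(k)}{h(j+1)}\le q$ for all $k\in\mathbb{Z}^{+}$. Then the systems $(L)$ and $(N)$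 are $\mathbb{Z}^{+}$-topologically equivalent, with homeomorphisms $H(k,\cdot)$ and $G(k,\cdot)=H^{-1}(k,\cdot)$ given by $$G(k,\xi)=x(k,0,y(0,k,\xi))=\Phi(k,0)\,y(0,k,\xi),\qquad H(k,\xi)=y(k,0,x(0,k,\xi)),$$ for all $k\in\mathbb{Z}^{+}$, $\xi\in\mathbb{R}^d$.
   Context: $\mathbb{Z}^{+}=\{0,1,2,\dots\}$; $|\cdot|$ is a vector norm on $\mathbb{R}^d$ and $\|\cdot\|$ its induced matrix norm; $A^{-1}(k)$ denotes $(A(k))^{-1}$. Transition matrix of $(L)$: $\Phi(k,n)=A(k-1)A(k-2)\cdots A(n)$ if $k>n$; $\Phi(k,k)=I$; $\Phi(k,n)=A^{-1}(k)A^{-1}(k+1)\cdots A^{-1}(n-1)$ if $k<n$. $k\mapsto x(k,m,\xi)=\Phi(k,m)\xi$ and $k\mapsto y(k,m,\eta)$, $k\in\mathbb{Z}^{+}$, denote the solutions of $(L)$ and $(N)$ with values $\xi$ and $\eta$, respectively, at $k=m$ (by (P6), solutions of $(N)$ are uniquely defined for $k<m$ as well). Topological equivalence: for $J\subseteq\mathbb{Z}$, the systems $(L)$ and $(N)$ are $J$-topologically equivalent if there is a function $H:J\times\mathbb{R}^d\to\mathbb{R}^d$ such that (i) if $x(k)$ is a solution of $(L)$ then $H[k,x(k)]$ is a solution of $(N)$; (ii) $H(k,u)-u$ is bounded on $J\times\mathbb{R}^d$; (iii) for each fixed $k\in J$, $u\mapsto H(k,u)$ is a homeomorphism of $\mathbb{R}^d$.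 In addition, the function $u\mapsto G(k,u)=H^{-1}(k,u)$ has properties (ii)–(iii) and maps solutions of $(N)$ into solutions of $(L)$. *)

theory Defs
  imports "HOL-Analysis.Analysis"
begin

text \<open>
  The vector norm is an arbitrary norm on \<open>real ^ 'd\<close>, passed as a function, and not necessarily
  the Euclidean norm of the type class. Continuity, homeomorphisms and bounded sets
  do not depend on this choice and are taken from the library.
\<close>

definition vector_norm :: "('a::real_vector \<Rightarrow> real) \<Rightarrow> bool" where
  "vector_norm N \<longleftrightarrow>
     (\<forall>x. 0 \<le> N x) \<and> (\<forall>x. N x = 0 \<longleftrightarrow> x = 0) \<and>
     (\<forall>c x. N (c *\<^sub>R x) = \<bar>c\<bar> * N x) \<and> (\<forall>x y. N (x + y) \<le> N x + N y)"

definition induced_norm :: "(real ^ 'd \<Rightarrow> real) \<Rightarrow> real ^ 'd ^ 'd \<Rightarrow> real" where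
  "induced_norm N B = (SUP x\<in>{x. N x = 1}. N (B *v x))"

text \<open>
  A first-order difference equation \<open>z(k+1) = F(k, z(k))\<close> is represented by its right-hand
  side. The time type is \<^typ>\<open>nat\<close> or \<^typ>\<open>int\<close>.
\<close>

definition is_solution :: "'k::semiring_1 set \<Rightarrow> ('k \<Rightarrow> 'v \<Rightarrow> 'v) \<Rightarrow> ('k \<Rightarrow> 'v) \<Rightarrow> bool" where
  "is_solution J F z \<longleftrightarrow> (\<forall>k. k \<in> J \<and> k + 1 \<in> J \<longrightarrow> z (k + 1) = F k (z k))"

definition linear_sys :: "('k \<Rightarrow> real ^ 'd ^ 'd) \<Rightarrow> 'k \<Rightarrow> real ^ 'd \<Rightarrow> real ^ 'd" where
  "linear_sys A k x = A k *v x"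

definition perturbed_sys ::
    "('k \<Rightarrow> real ^ 'd ^ 'd) \<Rightarrow> ('k \<Rightarrow> real ^ 'd \<Rightarrow> real ^ 'd) \<Rightarrow> 'k \<Rightarrow> real ^ 'd \<Rightarrow> real ^ 'd" where
  "perturbed_sys A f k y = A k *v y + f k y"

text \<open>
  The value at time \<open>k\<close> of the solution with value \<open>v\<close> at time \<open>m\<close>, where \<open>k < m\<close> is allowed. The
  description is meaningful only if every map \<open>F j\<close> is bijective, so that the solution
  exists and is unique on all of \<^typ>\<open>nat\<close>.
\<close>

definition sol_value :: "(nat \<Rightarrow> 'v \<Rightarrow> 'v) \<Rightarrow> nat \<Rightarrow> nat \<Rightarrow> 'v \<Rightarrow> 'v" where
  "sol_value F k m v = (THE z. is_solution UNIV F z \<and> z m = v) k"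

text \<open>
  \<open>A(k-1) \<cdots> A(n)\<close> for \<open>k > n\<close>, the identity for \<open>k = n\<close>, and
  \<open>A\<^sup>-\<^sup>1(k) \<cdots> A\<^sup>-\<^sup>1(n-1)\<close> for \<open>k < n\<close>; factors are listed from left to right.
\<close>

definition transition_matrix :: "(nat \<Rightarrow> real ^ 'd ^ 'd) \<Rightarrow> nat \<Rightarrow> nat \<Rightarrow> real ^ 'd ^ 'd" where
  "transition_matrix A k n =
     (if n \<le> k then foldr (\<lambda>j P. A j ** P) (rev [n..<k]) (mat 1)
      else foldr (\<lambda>j P. matrix_inv (A j) ** P) [k..<n] (mat 1))"

text \<open>
  \<open>homeomorphism\<close> makes \<open>G k\<close> the two-sided inverse of \<open>H k\<close>, so \<open>G\<close> is determined by \<open>H\<close> on \<open>J\<close>;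
  two systems are topologically equivalent iff such \<open>H\<close> and \<open>G\<close> exist.
\<close>

definition topological_equivalence ::
    "'k::semiring_1 set \<Rightarrow> ('k \<Rightarrow> 'v \<Rightarrow> 'v) \<Rightarrow> ('k \<Rightarrow> 'v \<Rightarrow> 'v) \<Rightarrow>
     ('k \<Rightarrow> 'v \<Rightarrow> 'v) \<Rightarrow> ('k \<Rightarrow> 'v \<Rightarrow> 'v::real_normed_vector) \<Rightarrow> bool" where
  "topological_equivalence J F F' H G \<longleftrightarrow>
     (\<forall>x. is_solution J F x \<longrightarrow> is_solution J F' (\<lambda>k. H k (x k))) \<and>
     (\<forall>y. is_solution J F' y \<longrightarrow> is_solution J F (\<lambda>k. G k (y k))) \<and>
     bounded {H k u - u | k u. k \<in> J} \<and>
     bounded {G k u - u | k u. k \<in> J} \<and>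
     (\<forall>k\<in>J. homeomorphism UNIV UNIV (H k) (G k))"

end

theory Submission imports Defs begin

text \<open>
  Every right-hand side \<open>y \<mapsto> A(k) y + f(k, y)\<close> is a homeomorphism of \<open>\<real>\<^sup>d\<close>: it is injective because
  \<open>A\<^sup>-\<^sup>1(k) f(k, \<cdot>)\<close> is a contraction for the given norm, it is surjective by Brouwer's fixed point
  theorem because \<open>f(k, \<cdot>)\<close> is continuous and bounded, and its inverse is continuous by
  invariance of domain (\<open>homeomorphism_linear_plus_bounded\<close>). Hence both systems have
  evolution maps \<open>X\<^sub>k\<close>, \<open>Y\<^sub>k\<close> from time \<open>0\<close> to time \<open>k\<close> that are homeomorphisms, and
  \<open>H(k, \<cdot>) = Y\<^sub>k \<circ> X\<^sub>k\<^sup>-\<^sup>1\<close>, \<open>G(k, \<cdot>) = X\<^sub>k \<circ> Y\<^sub>k\<^sup>-\<^sup>1\<close> carry solutions to solutions simply by matching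
  initial values at time \<open>0\<close>.

  What remains is that both maps stay within bounded distance of the identity. Both displacements
  are, up to sign, the difference \<open>Y\<^sub>k w - X\<^sub>k w\<close> of two solutions with a common value at time \<open>0\<close>:
  put \<open>w = X\<^sub>k\<^sup>-\<^sup>1 u\<close> for \<open>H\<close> and \<open>w = Y\<^sub>k\<^sup>-\<^sup>1 u\<close> for \<open>G\<close>. By variation of constants this difference is
  \<open>\<Sum>j<k. \<Phi>(k, j+1) f(j, Y\<^sub>j w)\<close>, and the estimate for \<open>\<Phi>\<close>, the bound for \<open>f\<close> and the
  summability assumption bound its norm by \<open>p\<close>, uniformly in \<open>k\<close> and \<open>w\<close>
  (\<open>evolution_displacement_bound\<close>). Matching the solutions at time \<open>0\<close> is what makes this sum run
  over the past of \<open>k\<close> only, where the decay of \<open>\<Phi>(k, j+1)\<close> is available.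
\<close>

section \<open>Norms on finite-dimensional space\<close>

lemma vector_normD:
  assumes "vector_norm N"
  shows "0 \<le> N x" "N x = 0 \<longleftrightarrow> x = 0" "N (c *\<^sub>R x) = \<bar>c\<bar> * N x" "N (x + y) \<le> N x + N y"
  using assms by (auto simp: vector_norm_def)

lemma vector_norm_minus:
  assumes "vector_norm N"
  shows "N (- x) = N x"
  using vector_normD(3)[OF assms, of "-1" x] by simp

lemma vector_norm_sum_le:
  assumes "vector_norm N"
  shows "N (sum g S) \<le> (\<Sum>j\<in>S. N (g j))"
proof (induction S rule: infinite_finite_induct)
  case (insert j S)
  then show ?case
    using vector_normD(4)[OF assms, of "g j" "sum g S"] by simp
qed (use vector_normD(2)[OF assms, of 0] in simp_all)

text \<open>
  A norm is a convex function, hence continuous on a Euclidean space, and so it attains a positive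
  minimum and a maximum on the unit sphere.
\<close>

lemma vector_norm_equivalent:
  fixes N :: "'a::euclidean_space \<Rightarrow> real"
  assumes N: "vector_norm N"
  obtains c C where "0 < c" "0 < C" "\<And>x. c * norm x \<le> N x" "\<And>x. N x \<le> C * norm x"
proof -
  have "convex_on UNIV N"
  proof (rule convex_onI)
    fix t :: real and x y :: 'a
    assume t: "0 < t" "t < 1"
    show "N ((1 - t) *\<^sub>R x + t *\<^sub>R y) \<le> (1 - t) * N x + t * N y"
      using vector_normD(4)[OF N, of "(1 - t) *\<^sub>R x" "t *\<^sub>R y"] t
      by (simp add: vector_normD(3)[OF N])
  qed simp
  then have cont: "continuous_on (sphere 0 1) N"
    using convex_on_continuous[of UNIV N] continuous_on_subset by blast
  have ne: "sphere (0::'a) 1 \<noteq> {}" by simp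
  obtain a where a: "a \<in> sphere 0 1" "\<And>x. x \<in> sphere 0 1 \<Longrightarrow> N a \<le> N x"
    using continuous_attains_inf[OF compact_sphere ne cont] by blast
  obtain b where b: "b \<in> sphere 0 1" "\<And>x. x \<in> sphere 0 1 \<Longrightarrow> N x \<le> N b"
    using continuous_attains_sup[OF compact_sphere ne cont] by blast
  have pos: "0 < N v" if "v \<in> sphere 0 1" for v
    using that vector_normD(1,2)[OF N, of v] by (cases "v = 0") auto
  have scale: "N x = norm x * N (sgn x)" for x
  proof -
    have "x = norm x *\<^sub>R sgn x" by (cases "x = 0") (simp_all add: sgn_div_norm)
    then show ?thesis using vector_normD(3)[OF N, of "norm x" "sgn x"] by simp
  qed
  have "N a * norm x \<le> N x \<and> N x \<le> N b * norm x" for x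
  proof (cases "x = 0")
    case True
    then show ?thesis using vector_normD(2)[OF N, of 0] by simp
  next
    case False
    then have "sgn x \<in> sphere 0 1" by (simp add: norm_sgn)
    then show ?thesis
      using a(2)[of "sgn x"] b(2)[of "sgn x"] scale[of x]
      by (metis mult.commute mult_left_mono norm_ge_zero)
  qed
  then show ?thesis using that[of "N a" "N b"] pos a(1) b(1) by blast
qed

text \<open>
  The supremum that defines the induced norm is taken over a bounded set, because \<open>N\<close> is
  equivalent to the Euclidean norm; for \<open>x \<noteq> 0\<close> the bound follows by scaling \<open>x\<close> to \<open>N\<close>-length one.
\<close>

lemma induced_norm_bound:
  fixes B :: "real ^ 'd ^ 'd"
  assumes N: "vector_norm N"
  shows "N (B *v x) \<le> induced_norm N B * N x"
proof (cases "x = 0")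
  case True
  then show ?thesis using vector_normD(2)[OF N, of 0] by simp
next
  case False
  obtain c C where c: "0 < c" "0 < C" "\<And>x. c * norm x \<le> N x" "\<And>x. N x \<le> C * norm x"
    using vector_norm_equivalent[OF N] by metis
  obtain K where K: "0 < K" "\<And>x. norm (B *v x) \<le> norm x * K"
    using bounded_linear.pos_bounded[of "(*v) B"] by auto
  have bdd: "bdd_above ((\<lambda>x. N (B *v x)) ` {x. N x = 1})"
  proof (rule bdd_aboveI2)
    fix u assume "u \<in> {x. N x = 1}"
    then have "norm u \<le> 1 / c" using c(1) c(3)[of u] by (simp add: field_simps)
    then have "norm (B *v u) \<le> 1 / c * K"
      using K(2)[of u] K(1) by (meson less_imp_le mult_right_mono order_trans)
    then show "N (B *v u) \<le> C * (1 / c * K)"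
      using c(4)[of "B *v u"] c(2) by (meson less_imp_le mult_left_mono order_trans)
  qed
  have Nx: "0 < N x" using False vector_normD(1,2)[OF N, of x] by linarith
  define u where "u = (1 / N x) *\<^sub>R x"
  have "N u = 1" using Nx by (simp add: u_def vector_normD(3)[OF N])
  then have le: "N (B *v u) \<le> induced_norm N B"
    unfolding induced_norm_def by (intro cSUP_upper[OF _ bdd]) simp
  have "B *v x = N x *\<^sub>R (B *v u)"
    using Nx by (simp add: u_def matrix_vector_mult_scaleR)
  then have "N (B *v x) = N x * N (B *v u)"
    using Nx by (simp add: vector_normD(3)[OF N])
  then show ?thesis using le Nx by (simp add: mult.commute)
qed

section \<open>Bounded perturbations of invertible linear maps\<close>

lemma matrix_inv_inverse:
  assumes "invertible B"
  shows "B ** matrix_inv B = mat 1" "matrix_inv B ** B = mat 1"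
  using someI_ex[OF assms[unfolded invertible_def]] by (simp_all add: matrix_inv_def)

text \<open>
  A solution \<open>y\<close> of \<open>B y + g y = z\<close> is a fixed point of \<open>y \<mapsto> B\<^sup>-\<^sup>1 (z - g y)\<close>, a continuous map with
  bounded range; Brouwer's theorem applies on a ball that contains this range. Using Brouwer rather
  than Banach avoids a second, non-Euclidean metric on the space.
\<close>

lemma surj_linear_plus_bounded:
  fixes B :: "real ^ 'd ^ 'd"
  assumes inv: "invertible B"
    and cont: "continuous_on UNIV g"
    and bdd: "bounded (range g)"
  shows "surj (\<lambda>y. B *v y + g y)"
proof -
  have "\<exists>y. z = B *v y + g y" for z :: "real ^ 'd"
  proof -
    define T where "T y = matrix_inv B *v (z - g y)" for y
    have "range T = (*v) (matrix_inv B) ` (\<lambda>w. z - w) ` range g"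
      by (auto simp: T_def)
    moreover have "bounded ((\<lambda>w. z - w) ` range g)"
      using bounded_minus_comp[of "\<lambda>_. z" "range g" "\<lambda>w. w"] bdd
      by (simp add: image_constant_conv)
    ultimately have "bounded (range T)"
      by (simp add: bounded_linear_image)
    then obtain R where R: "0 < R" "\<And>y. norm (T y) \<le> R"
      unfolding bounded_pos by auto
    have "continuous_on UNIV T"
      unfolding T_def
      by (intro bounded_linear.continuous_on[OF matrix_vector_mul_bounded_linear]
        continuous_intros cont)
    then have contT: "continuous_on (cball 0 R) T"
      using continuous_on_subset by blast
    obtain y where "T y = y"
      using brouwer[OF compact_cball convex_cball _ contT] R by force
    then have "B *v y = (B ** matrix_inv B) *v (z - g y)"
      by (metis T_def matrix_vector_mul_assoc)
    then have "z = B *v y + g y" by (simp add: matrix_inv_inverse[OF inv])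
    then show ?thesis ..
  qed
  then show ?thesis by (simp add: surj_def)
qed

lemma homeomorphism_linear_plus_bounded:
  fixes B :: "real ^ 'd ^ 'd"
  assumes N: "vector_norm N"
    and inv: "invertible B"
    and cont: "continuous_on UNIV g"
    and bdd: "bounded (range g)"
    and lip: "\<And>y y'. N (g y - g y') \<le> L * N (y - y')"
    and small: "induced_norm N (matrix_inv B) * L < 1"
  obtains k where "homeomorphism UNIV UNIV (\<lambda>y. B *v y + g y) k"
proof -
  let ?F = "\<lambda>y. B *v y + g y"
  have inj: "inj ?F"
  proof (rule injI, rule ccontr)
    fix y y' assume eq: "?F y = ?F y'" and "y \<noteq> y'"
    then have pos: "0 < N (y - y')"
      using vector_normD(1,2)[OF N, of "y - y'"] by (simp add: less_le)
    have "B *v (y - y') = g y' - g y"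
      using eq by (simp add: matrix_vector_mult_diff_distrib algebra_simps)
    then have "(matrix_inv B ** B) *v (y - y') = matrix_inv B *v (g y' - g y)"
      by (metis matrix_vector_mul_assoc)
    then have fix_eq: "y - y' = matrix_inv B *v (g y' - g y)"
      by (simp add: matrix_inv_inverse[OF inv])
    let ?b = "induced_norm N (matrix_inv B)"
    have le: "N (y - y') \<le> ?b * N (g y' - g y)"
      using induced_norm_bound[OF N, of "matrix_inv B" "g y' - g y"] fix_eq by simp
    have "0 \<le> ?b"
      using le pos vector_normD(1)[OF N, of "g y' - g y"]
      by (smt (verit) mult_nonpos_nonneg)
    moreover have "N (g y' - g y) \<le> L * N (y - y')"
      using lip[of y y'] vector_norm_minus[OF N, of "g y - g y'"] by simp
    ultimately have "N (y - y') \<le> ?b * L * N (y - y')"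
      using le mult_left_mono[of "N (g y' - g y)" "L * N (y - y')" ?b]
      by (simp add: mult.assoc)
    then show False using small pos by (simp add: mult_le_cancel_right1)
  qed
  have "continuous_on UNIV ?F"
    by (intro bounded_linear.continuous_on[OF matrix_vector_mul_bounded_linear]
        continuous_intros cont)
  then obtain k where "homeomorphism UNIV (range ?F) ?F k"
    using invariance_of_domain_homeomorphism[of UNIV ?F] inj by auto
  then show ?thesis using that surj_linear_plus_bounded[OF inv cont bdd] by simp
qed

section \<open>Evolution maps\<close>

primrec evolution :: "(nat \<Rightarrow> 'v \<Rightarrow> 'v) \<Rightarrow> nat \<Rightarrow> 'v \<Rightarrow> 'v" where
  "evolution F 0 v = v"
| "evolution F (Suc k) v = F k (evolution F k v)"

lemma is_solution_nat_iff:
  "is_solution (UNIV :: nat set) F z \<longleftrightarrow> (\<forall>k. z k = evolution F k (z 0))"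
proof
  assume "is_solution UNIV F z"
  then have step: "z (Suc k) = F k (z k)" for k by (simp add: is_solution_def)
  have "z k = evolution F k (z 0)" for k
    by (induction k) (simp_all add: step)
  then show "\<forall>k. z k = evolution F k (z 0)" by blast
next
  assume *: "\<forall>k. z k = evolution F k (z 0)"
  show "is_solution UNIV F z"
    unfolding is_solution_def
  proof safe
    fix k
    show "z (k + 1) = F k (z k)"
      using *[rule_format, of "k + 1"] *[rule_format, of k] by simp
  qed
qed

lemma is_solution_evolution: "is_solution UNIV F (\<lambda>k. evolution F k v)"
  by (simp add: is_solution_nat_iff)

lemma homeomorphism_evolution:
  fixes F :: "nat \<Rightarrow> 'v::topological_space \<Rightarrow> 'v"
  assumes "\<And>j. \<exists>g. homeomorphism UNIV UNIV (F j) g"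
  shows "homeomorphism UNIV UNIV (evolution F k) (inv (evolution F k))"
proof -
  have "\<exists>g. homeomorphism UNIV UNIV (evolution F k) g"
  proof (induction k)
    case 0
    have "evolution F 0 = (\<lambda>v. v)" by (simp add: fun_eq_iff)
    then show ?case using homeomorphism_ident by metis
  next
    case (Suc k)
    have "evolution F (Suc k) = F k \<circ> evolution F k" by (simp add: fun_eq_iff)
    then show ?case using Suc assms[of k] homeomorphism_compose by metis
  qed
  then obtain g where g: "homeomorphism UNIV UNIV (evolution F k) g" ..
  then have "inv (evolution F k) = g"
    by (intro inv_equality) (auto simp: homeomorphism_def)
  with g show ?thesis by simp
qed

text \<open>
  When the evolution maps are bijections, the unique solution through \<open>v\<close> at time \<open>m\<close> starts from
  the preimage of \<open>v\<close> at time \<open>0\<close>, whether \<open>k\<close> lies before or after \<open>m\<close>.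
\<close>

lemma sol_value_eq_evolution:
  assumes bij: "bij (evolution F m)"
  shows "sol_value F k m v = evolution F k (inv (evolution F m) v)"
proof -
  have "(THE z. is_solution UNIV F z \<and> z m = v) = (\<lambda>k. evolution F k (inv (evolution F m) v))"
  proof (rule the_equality)
    show "is_solution UNIV F (\<lambda>k. evolution F k (inv (evolution F m) v)) \<and>
        evolution F m (inv (evolution F m) v) = v"
      using bij by (simp add: is_solution_evolution bij_is_surj surj_f_inv_f)
    fix z assume z: "is_solution UNIV F z \<and> z m = v"
    then have ev: "z k = evolution F k (z 0)" for k
      unfolding is_solution_nat_iff by blast
    have "v = evolution F m (z 0)" using z ev[of m] by simp
    then have z0: "z 0 = inv (evolution F m) v"
      using bij by (simp add: bij_is_inj inv_f_f)
    show "z = (\<lambda>k. evolution F k (inv (evolution F m) v))"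
      unfolding z0[symmetric] by (rule ext, rule ev)
  qed
  then show ?thesis by (simp add: sol_value_def)
qed

section \<open>Variation of constants\<close>

lemma transition_matrix_refl [simp]: "transition_matrix A n n = mat 1"
  by (simp add: transition_matrix_def)

lemma transition_matrix_Suc:
  "n \<le> k \<Longrightarrow> transition_matrix A (Suc k) n = A k ** transition_matrix A k n"
  by (simp add: transition_matrix_def)

lemma evolution_linear_sys:
  "evolution (linear_sys A) k v = transition_matrix A k 0 *v v"
  by (induction k) (simp_all add: linear_sys_def transition_matrix_Suc matrix_vector_mul_assoc)

lemma matrix_vector_mult_sum:
  fixes B :: "real ^ 'n ^ 'm"
  shows "B *v sum g S = (\<Sum>j\<in>S. B *v g j)"
  by (rule linear_sum) simp

lemma variation_of_constants:
  fixes A :: "nat \<Rightarrow> real ^ 'd ^ 'd" and f :: "nat \<Rightarrow> real ^ 'd \<Rightarrow> real ^ 'd"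
  defines "Y \<equiv> evolution (perturbed_sys A f)"
  shows "Y k v - evolution (linear_sys A) k v =
    (\<Sum>j<k. transition_matrix A k (Suc j) *v f j (Y j v))"
proof (induction k)
  case 0
  then show ?case by (simp add: Y_def)
next
  case (Suc k)
  have "Y (Suc k) v - evolution (linear_sys A) (Suc k) v =
      A k *v (Y k v - evolution (linear_sys A) k v) + f k (Y k v)"
    by (simp add: Y_def perturbed_sys_def linear_sys_def matrix_vector_mult_diff_distrib)
  also have "A k *v (Y k v - evolution (linear_sys A) k v) =
      (\<Sum>j<k. transition_matrix A (Suc k) (Suc j) *v f j (Y j v))"
    unfolding Suc.IH matrix_vector_mult_sum
    by (intro sum.cong refl) (simp add: transition_matrix_Suc matrix_vector_mul_assoc)
  finally show ?case by simp
qed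

lemma evolution_displacement_bound:
  fixes A :: "nat \<Rightarrow> real ^ 'd ^ 'd"
  assumes N: "vector_norm N"
    and f: "\<And>k y. N (f k y) \<le> \<mu> k"
    and \<Phi>: "\<And>k n. n \<le> k \<Longrightarrow> induced_norm N (transition_matrix A k n) \<le> \<rho> n * (h k / h n)"
    and nonneg: "\<And>n. 0 \<le> \<rho> n" "\<And>n. 0 < h n"
    and p: "\<And>k. (\<Sum>j<k. \<mu> j * \<rho> (j + 1) * (h k / h (j + 1))) \<le> p"
  shows "N (evolution (perturbed_sys A f) k v - evolution (linear_sys A) k v) \<le> p"
proof -
  let ?y = "\<lambda>j. evolution (perturbed_sys A f) j v"
  have "N (?y k - evolution (linear_sys A) k v) \<le>
      (\<Sum>j<k. N (transition_matrix A k (Suc j) *v f j (?y j)))"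
    unfolding variation_of_constants by (rule vector_norm_sum_le[OF N])
  also have "\<dots> \<le> (\<Sum>j<k. \<mu> j * \<rho> (j + 1) * (h k / h (j + 1)))"
  proof (rule sum_mono)
    fix j assume "j \<in> {..<k}"
    then have "induced_norm N (transition_matrix A k (Suc j)) \<le> \<rho> (Suc j) * (h k / h (Suc j))"
      by (intro \<Phi>) simp
    moreover have "0 \<le> \<rho> (Suc j) * (h k / h (Suc j))"
      using nonneg by (simp add: less_imp_le)
    ultimately have "induced_norm N (transition_matrix A k (Suc j)) * N (f j (?y j)) \<le>
        \<rho> (Suc j) * (h k / h (Suc j)) * \<mu> j"
      using f[of j "?y j"] vector_normD(1)[OF N] by (intro mult_mono) auto
    then show "N (transition_matrix A k (Suc j) *v f j (?y j)) \<le>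
        \<mu> j * \<rho> (j + 1) * (h k / h (j + 1))"
      using induced_norm_bound[OF N, of "transition_matrix A k (Suc j)" "f j (?y j)"]
      by (simp add: mult_ac)
  qed
  also have "\<dots> \<le> p" by (rule p)
  finally show ?thesis .
qed

section \<open>Topological equivalence\<close>

text \<open>
  Any two systems with homeomorphic evolution maps are conjugated by matching initial values. The
  conjugacy is close to the identity as soon as solutions with equal initial values stay close.
\<close>

lemma topological_equivalence_evolution:
  fixes F F' :: "nat \<Rightarrow> 'v \<Rightarrow> 'v::real_normed_vector"
  defines "X \<equiv> evolution F" and "Y \<equiv> evolution F'"
  assumes hX: "\<And>k. homeomorphism UNIV UNIV (X k) (inv (X k))"
    and hY: "\<And>k. homeomorphism UNIV UNIV (Y k) (inv (Y k))"
    and close: "\<And>k v. norm (Y k v - X k v) \<le> r"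
  shows "topological_equivalence UNIV F F' (\<lambda>k. Y k \<circ> inv (X k)) (\<lambda>k. X k \<circ> inv (Y k))"
proof -
  have X: "inv (X k) (X k v) = v" "X k (inv (X k) v) = v" for k v
    using hX[of k] by (auto simp: homeomorphism_def)
  have Y: "inv (Y k) (Y k v) = v" "Y k (inv (Y k) v) = v" for k v
    using hY[of k] by (auto simp: homeomorphism_def)
  have "is_solution UNIV F' (\<lambda>k. (Y k \<circ> inv (X k)) (x k))" if "is_solution UNIV F x" for x
  proof -
    have "(\<lambda>k. (Y k \<circ> inv (X k)) (x k)) = (\<lambda>k. Y k (x 0))"
    proof
      fix k
      have "x k = X k (x 0)"
        using that unfolding is_solution_nat_iff X_def by blast
      then show "(Y k \<circ> inv (X k)) (x k) = Y k (x 0)"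
        using X(1)[of k "x 0"] by simp
    qed
    then show ?thesis by (simp add: Y_def is_solution_evolution)
  qed
  moreover have "is_solution UNIV F (\<lambda>k. (X k \<circ> inv (Y k)) (y k))" if "is_solution UNIV F' y" for y
  proof -
    have "(\<lambda>k. (X k \<circ> inv (Y k)) (y k)) = (\<lambda>k. X k (y 0))"
    proof
      fix k
      have "y k = Y k (y 0)"
        using that unfolding is_solution_nat_iff Y_def by blast
      then show "(X k \<circ> inv (Y k)) (y k) = X k (y 0)"
        using Y(1)[of k "y 0"] by simp
    qed
    then show ?thesis by (simp add: X_def is_solution_evolution)
  qed
  moreover have "norm (Y k (inv (X k) u) - u) \<le> r" for k u
    using close[of k "inv (X k) u"] by (simp add: X(2))
  then have "bounded {(Y k \<circ> inv (X k)) u - u | k u. k \<in> UNIV}"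
    by (intro boundedI[of _ r]) auto
  moreover have "norm (X k (inv (Y k) u) - u) \<le> r" for k u
    using close[of k "inv (Y k) u"] by (simp add: Y(2) norm_minus_commute)
  then have "bounded {(X k \<circ> inv (Y k)) u - u | k u. k \<in> UNIV}"
    by (intro boundedI[of _ r]) auto
  moreover have "homeomorphism UNIV UNIV (Y k \<circ> inv (X k)) (X k \<circ> inv (Y k))" for k
    using homeomorphism_compose[OF homeomorphism_symD[OF hX] hY] .
  ultimately show ?thesis by (simp add: topological_equivalence_def)
qed

theorem corollary3:
  fixes A :: "nat \<Rightarrow> real ^ 'd ^ 'd"
    and f :: "nat \<Rightarrow> real ^ 'd \<Rightarrow> real ^ 'd"
    and N :: "real ^ 'd \<Rightarrow> real"
    and M p q :: real
    and \<gamma> \<mu> \<rho> h :: "nat \<Rightarrow> real"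
  assumes norm: "vector_norm N"
    and cont: "\<forall>k. continuous_on UNIV (f k)"
    and P1_inv: "\<forall>k. invertible (A k)"
    and P1_bdd: "bdd_above (range (\<lambda>k. induced_norm N (A k)))"
      "bdd_above (range (\<lambda>k. induced_norm N (matrix_inv (A k))))"
    and P1_M: "M \<ge> 1"
      "max (SUP k. induced_norm N (A k)) (SUP k. induced_norm N (matrix_inv (A k))) = M"
    and P3_nonneg: "\<forall>k. 0 \<le> \<gamma> k" "\<forall>k. 0 \<le> \<mu> k"
    and P3_lipschitz: "\<forall>k y y'. N (f k y - f k y') \<le> \<gamma> k * N (y - y')"
    and P3_bound: "\<forall>k y. N (f k y) \<le> \<mu> k"
    and P6: "\<forall>l. induced_norm N (matrix_inv (A l)) * \<gamma> l < 1"
    and S1_rho: "\<forall>n. 0 \<le> \<rho> n" "bdd_above (range \<rho>)"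
    and S1_h: "\<forall>n. 0 < h n" "decseq h" "h \<longlonglongrightarrow> 0" "h 0 = 1"
    and S1: "\<forall>k n. n \<le> k \<longrightarrow> induced_norm N (transition_matrix A k n) \<le> \<rho> n * (h k / h n)"
    and S2: "\<forall>k. (\<Sum>j<k. \<mu> j * \<rho> (j + 1) * (h k / h (j + 1))) \<le> p"
    and S3: "q < 1" "\<forall>k. (\<Sum>j<k. \<gamma> j * \<rho> (j + 1) * (h k / h (j + 1))) \<le> q"
  shows "\<exists>H G. topological_equivalence UNIV (linear_sys A) (perturbed_sys A f) H G \<and>
      (\<forall>k \<xi>. G k \<xi> = sol_value (linear_sys A) k 0 (sol_value (perturbed_sys A f) 0 k \<xi>) \<and>
             G k \<xi> = transition_matrix A k 0 *v sol_value (perturbed_sys A f) 0 k \<xi> \<and>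
             H k \<xi> = sol_value (perturbed_sys A f) k 0 (sol_value (linear_sys A) 0 k \<xi>))"
proof -
  let ?X = "evolution (linear_sys A)" and ?Y = "evolution (perturbed_sys A f)"
  obtain c C where c: "0 < c" "0 < C" "\<And>x. c * norm x \<le> N x" "\<And>x. N x \<le> C * norm x"
    using vector_norm_equivalent[OF norm] by metis
  have norm_le: "norm x \<le> r / c" if "N x \<le> r" for x r
    using c(1) c(3)[of x] that by (simp add: field_simps)
  have "\<exists>g. homeomorphism UNIV UNIV (perturbed_sys A f j) g" for j
  proof -
    have "bounded (range (f j))"
      using norm_le P3_bound by (intro boundedI[of _ "\<mu> j / c"]) auto
    then obtain g where "homeomorphism UNIV UNIV (\<lambda>y. A j *v y + f j y) g"
      using homeomorphism_linear_plus_bounded[OF norm, of "A j" "f j" "\<gamma> j"]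
        P1_inv cont P3_lipschitz P6 by blast
    then show ?thesis by (auto simp: perturbed_sys_def[abs_def])
  qed
  then have hY: "homeomorphism UNIV UNIV (?Y k) (inv (?Y k))" for k
    by (rule homeomorphism_evolution)
  have "\<exists>g. homeomorphism UNIV UNIV (linear_sys A j) g" for j
  proof -
    have "N 0 = 0" using vector_normD(2)[OF norm] by blast
    then obtain g where "homeomorphism UNIV UNIV (\<lambda>y. A j *v y + 0) g"
      using homeomorphism_linear_plus_bounded[OF norm, of "A j" "\<lambda>_. 0" 0] P1_inv by auto
    then show ?thesis by (auto simp: linear_sys_def[abs_def])
  qed
  then have hX: "homeomorphism UNIV UNIV (?X k) (inv (?X k))" for k
    by (rule homeomorphism_evolution)
  have close: "norm (?Y k v - ?X k v) \<le> p / c" for k v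
    using S1 S2 S1_rho(1) S1_h(1) P3_bound
    by (intro norm_le evolution_displacement_bound[OF norm, of f \<mu> A \<rho> h]) auto
  define H where "H k = ?Y k \<circ> inv (?X k)" for k
  define G where "G k = ?X k \<circ> inv (?Y k)" for k
  have "topological_equivalence UNIV (linear_sys A) (perturbed_sys A f) H G"
    unfolding H_def G_def by (rule topological_equivalence_evolution[OF hX hY close])
  moreover have bij: "bij (?X k)" "bij (?Y k)" for k
    using hX[of k] hY[of k] by (auto simp: homeomorphism_def bij_def intro: inj_on_inverseI)
  have X0: "evolution F 0 = id" for F :: "nat \<Rightarrow> real ^ 'd \<Rightarrow> real ^ 'd" by (simp add: fun_eq_iff)
  have "G k \<xi> = sol_value (linear_sys A) k 0 (sol_value (perturbed_sys A f) 0 k \<xi>)"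
    and "G k \<xi> = transition_matrix A k 0 *v sol_value (perturbed_sys A f) 0 k \<xi>"
    and "H k \<xi> = sol_value (perturbed_sys A f) k 0 (sol_value (linear_sys A) 0 k \<xi>)" for k \<xi>
    by (simp_all add: sol_value_eq_evolution bij X0 G_def H_def flip: evolution_linear_sys)
  ultimately show ?thesis by blast
qed

end
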